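(* Let $m,n,p\ge 0$ be integers. There is a sign preserving bijection between the set of degenerate rooted synchronized partitions of $p$ in $\mathcal{R}_{m,n}$ and the set of synchronized partitions of $p$ in $\mathcal{S}_{m,n}$ that do not contain the zero part.
   Context: Let $\alpha=(\alpha_1>\alpha_2>\cdots>\alpha_r)$ be a (possibly empty) partition with distinct positive parts, and let $\beta=(\beta_1>\beta_2>\cdots>\beta_s)$ be a (possibly empty) partition with distinct nonnegative parts, i.e. the last part $\beta_s$ is allowed to be $0$ (a zero part counts towards the length). Write $l(\alpha)=r$, $l(\beta)=s$, and $|\alpha|,|\beta|$ for the sums of parts. The synchronized partition $S(\alpha,\beta)$ is the two-row array with top row $\alpha$ and bottom row $\beta$, in which $|r-s|$ symbols $*$ are appended at the end of the shorter row so that both rows have the same length (no stars if $r=s$). It is a synchronized partition of $p=|\alpha|+|\beta|$. The discrepancy is $r-s$. Stars are in the bottom row if $r>s$ and in the top row if $r<s$. It does not contain the zero part if $0$ is not a part of $\beta$. A rooted synchronized partition is a synchronized partition (necessarily of nonzero discrepancy) together with one distinguished star among its $|r-s|$ stars, denoted $\bar{*}$ (the barred star). The set $\mathcal{S}_{m,n}$ (respectively $\mathcal{R}_{m,n}$) consists of all synchronized partitions (respectively rooted synchronized partitions) $S(\alpha,\beta)$ with $\alpha_1\le m$ and $\beta_1\le n$ (each condition being vacuous if the corresponding partition is empty). A rooted synchronized partition is called degenerate if it has one of the following two forms: (i) $l(\alpha)>l(\beta)$, $\beta$ has no zero part, and the barred star is the first (leftmost) star of the bottom row; (ii) $l(\alpha)<l(\beta)$,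 $\beta$ has a zero part, and the barred star is the last (rightmost) star of the top row, i.e. the one in the same column as the zero part. The sign of a rooted synchronized partition $S$ is $(-1)^{\delta(S)}$, where $\delta(S)$ is the number of stars in $S$, except that a barred star in the top row is not counted (a barred star in the bottom row is counted). So $\delta(S)=l(\alpha)-l(\beta)$ if $l(\alpha)>l(\beta)$, and $\delta(S)=l(\beta)-l(\alpha)-1$ if $l(\alpha)<l(\beta)$. The sign of an (unrooted) synchronized partition of discrepancy $k$ is $(-1)^k$. A bijection is sign preserving if each element has the same sign as its image. *)

theory Defs
  imports Main
begin

datatype entry = Part nat | Star | BarredStar

text \<open>Two-row arrays, given as (top row, bottom row).\<close>

type_synonym array = "entry list \<times> entry list"

definition row_parts :: "entry list \<Rightarrow> nat list" where
  "row_parts row = [k. Part k \<leftarrow> row]"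

text \<open>Partitions are listed in decreasing order. In a distinct nonnegative partition the last part
  may be \<open>0\<close>, and then it counts towards the length.\<close>

definition distinct_positive_partition :: "nat list \<Rightarrow> bool" where
  "distinct_positive_partition \<alpha> \<longleftrightarrow> sorted_wrt (>) \<alpha> \<and> (\<forall>k\<in>set \<alpha>. k > 0)"

definition distinct_nonneg_partition :: "nat list \<Rightarrow> bool" where
  "distinct_nonneg_partition \<beta> \<longleftrightarrow> sorted_wrt (>) \<beta>"

text \<open>The subtractions are truncated, so that only the shorter row is padded.\<close>

definition sync :: "nat list \<Rightarrow> nat list \<Rightarrow> array" where
  "sync \<alpha> \<beta> =
     (map Part \<alpha> @ replicate (length \<beta> - length \<alpha>) Star,
      map Part \<beta> @ replicate (length \<alpha> - length \<beta>) Star)"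

definition sync_partitions :: "nat \<Rightarrow> nat \<Rightarrow> array set" where
  "sync_partitions m n =
     {sync \<alpha> \<beta> | \<alpha> \<beta>. distinct_positive_partition \<alpha> \<and> distinct_nonneg_partition \<beta> \<and>
        (\<alpha> \<noteq> [] \<longrightarrow> hd \<alpha> \<le> m) \<and> (\<beta> \<noteq> [] \<longrightarrow> hd \<beta> \<le> n)}"

text \<open>A star is distinguished by replacing it with the barred star.\<close>

definition rootings :: "array \<Rightarrow> array set" where
  "rootings = (\<lambda>(T, B).
     {(T[i := BarredStar], B) | i. i < length T \<and> T ! i = Star} \<union>
     {(T, B[i := BarredStar]) | i. i < length B \<and> B ! i = Star})"

definition rooted_sync_partitions :: "nat \<Rightarrow> nat \<Rightarrow> array set" where
  "rooted_sync_partitions m n = (\<Union>S\<in>sync_partitions m n. rootings S)"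

definition weight :: "array \<Rightarrow> nat" where
  "weight = (\<lambda>(T, B). sum_list (row_parts T) + sum_list (row_parts B))"

definition contains_zero_part :: "array \<Rightarrow> bool" where
  "contains_zero_part = (\<lambda>(T, B). Part 0 \<in> set B)"

definition discrepancy :: "array \<Rightarrow> int" where
  "discrepancy = (\<lambda>(T, B). int (length (row_parts T)) - int (length (row_parts B)))"

definition sync_sign :: "array \<Rightarrow> int" where
  "sync_sign S = (- 1) ^ nat \<bar>discrepancy S\<bar>"

text \<open>A barred star is counted in the bottom row but not in the top row.\<close>

definition rooted_star_count :: "array \<Rightarrow> nat" where
  "rooted_star_count =
     (\<lambda>(T, B). count_list T Star + count_list B Star + count_list B BarredStar)"

definition rooted_sign :: "array \<Rightarrow> int" where
  "rooted_sign S = (- 1) ^ rooted_star_count S"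

definition barred_star_first :: "entry list \<Rightarrow> bool" where
  "barred_star_first row \<longleftrightarrow> (\<exists>xs ys. row = xs @ BarredStar # ys \<and> Star \<notin> set xs)"

definition barred_star_last :: "entry list \<Rightarrow> bool" where
  "barred_star_last row \<longleftrightarrow> (\<exists>xs ys. row = xs @ BarredStar # ys \<and> Star \<notin> set ys)"

definition degenerate :: "array \<Rightarrow> bool" where
  "degenerate S \<longleftrightarrow>
     discrepancy S > 0 \<and> \<not> contains_zero_part S \<and> barred_star_first (snd S) \<or>
     discrepancy S < 0 \<and> contains_zero_part S \<and> barred_star_last (fst S)"

end

theory Submission imports Defs begin

text \<open>
  Being degenerate pins down the barred star, so a degenerate rooted synchronized partition carries
  no more information than the pair of its rows, and the bijection forgets the root and deletes the
  zero part, if there is one. Let \<open>\<alpha>\<close> and \<open>\<beta>\<close> be the rows of the result, which have positive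
  parts only. If \<open>l(\<alpha>) > l(\<beta>)\<close>, the preimage is \<open>S(\<alpha>,\<beta>)\<close> with its first bottom star barred: no
  zero part can have been deleted, because a row \<open>\<beta>\<close> followed by \<open>0\<close> would still not be longer
  than \<open>\<alpha>\<close>. If \<open>l(\<alpha>) \<le> l(\<beta>)\<close>, the row \<open>\<beta>\<close> followed by \<open>0\<close> is strictly longer than \<open>\<alpha>\<close>, so
  that the column of the zero part has a star on top, and barring this star gives the preimage.
  In the first case the bar falls on a counted star, and the number of stars does not change.
  In the second case the additional star is the barred one in the top row, which is not counted.

  Hence both sets are parametrized by the same pairs \<open>(\<alpha>,\<beta>)\<close> (\<open>unrooted_parametrization\<close> and
  \<open>degenerate_parametrization\<close>), and these pairs can be read off from either kind of array.
\<close>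

text \<open>The inverse bijection, as a function of the two rows of the unrooted array.\<close>

definition degenerate_rooting :: "nat list \<Rightarrow> nat list \<Rightarrow> array" where
  "degenerate_rooting \<alpha> \<beta> =
     (if length \<beta> < length \<alpha>
      then (map Part \<alpha>, map Part \<beta> @ BarredStar # replicate (length \<alpha> - length \<beta> - 1) Star)
      else (map Part \<alpha> @ replicate (length \<beta> - length \<alpha>) Star @ [BarredStar],
            map Part \<beta> @ [Part 0]))"

definition unroot_and_drop_zero :: "array \<Rightarrow> array" where
  "unroot_and_drop_zero S = sync (row_parts (fst S)) (filter ((<) 0) (row_parts (snd S)))"

definition positive_pairs :: "nat \<Rightarrow> nat \<Rightarrow> nat \<Rightarrow> (nat list \<times> nat list) set" where
  "positive_pairs m n p =
     {(\<alpha>, \<beta>). distinct_positive_partition \<alpha> \<and> distinct_positive_partition \<beta> \<and>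
        (\<alpha> \<noteq> [] \<longrightarrow> hd \<alpha> \<le> m) \<and> (\<beta> \<noteq> [] \<longrightarrow> hd \<beta> \<le> n) \<and> sum_list \<alpha> + sum_list \<beta> = p}"

section \<open>Rows of parts and stars\<close>

lemma row_parts_simps [simp]:
  "row_parts [] = []"
  "row_parts (Part k # row) = k # row_parts row"
  "row_parts (Star # row) = row_parts row"
  "row_parts (BarredStar # row) = row_parts row"
  "row_parts (row @ row') = row_parts row @ row_parts row'"
  by (simp_all add: row_parts_def)

lemma row_parts_map_Part [simp]: "row_parts (map Part \<alpha>) = \<alpha>"
  by (induction \<alpha>) auto

lemma row_parts_replicate_Star [simp]: "row_parts (replicate k Star) = []"
  by (induction k) auto

lemma count_list_map_Part [simp]:
  "count_list (map Part \<alpha>) Star = 0" "count_list (map Part \<alpha>) BarredStar = 0"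
  by (auto simp: count_list_0_iff)

lemma count_list_replicate [simp]:
  "count_list (replicate k x) y = (if x = y then k else 0)"
  by (induction k) auto

lemma star_in_row_barred:
  "(map Part \<alpha> @ replicate (j + Suc l) Star)[length \<alpha> + j := BarredStar] =
     map Part \<alpha> @ replicate j Star @ BarredStar # replicate l Star"
proof -
  have "map Part \<alpha> @ replicate (j + Suc l) Star =
          (map Part \<alpha> @ replicate j Star) @ Star # replicate l Star"
    by (simp only: replicate_add replicate_Suc append_assoc)
  then show ?thesis
    using list_update_length [of "map Part \<alpha> @ replicate j Star" Star "replicate l Star"] by simp
qed

lemma bar_star_in_row:
  assumes "i < length (map Part \<alpha> @ replicate k Star)"
    and "(map Part \<alpha> @ replicate k Star) ! i = Star"
  obtains j l where "k = j + Suc l"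
    and "(map Part \<alpha> @ replicate k Star)[i := BarredStar] =
           map Part \<alpha> @ replicate j Star @ BarredStar # replicate l Star"
proof -
  have i: "length \<alpha> \<le> i"
    using assms by (cases "i < length \<alpha>") (auto simp: nth_append)
  then obtain j where j: "i = length \<alpha> + j"
    by (rule le_Suc_ex [THEN exE])
  moreover from this obtain l where "k = j + Suc l"
    using assms(1) less_imp_Suc_add [of j k] by auto
  ultimately show thesis
    using star_in_row_barred that by simp
qed

text \<open>
  There is only one bar in such a row, so the decompositions that are quantified over in the
  definitions of the first and the last barred star are unique.
\<close>

lemma row_split_at_bar:
  "map Part \<alpha> @ replicate j Star @ BarredStar # replicate l Star = xs @ BarredStar # ys \<longleftrightarrow>
     xs = map Part \<alpha> @ replicate j Star \<and> ys = replicate l Star"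
  (is "?L \<longleftrightarrow> ?R")
proof
  assume ?L
  then have eq: "(map Part \<alpha> @ replicate j Star) @ BarredStar # replicate l Star =
                   xs @ BarredStar # ys"
    by simp
  have "BarredStar \<notin> set (map Part \<alpha> @ replicate j Star)" "BarredStar \<notin> set (replicate l Star)"
    by auto
  with eq show ?R
    using append_Cons_eq_iff by metis
qed simp

lemma barred_star_first_row_iff:
  "barred_star_first (map Part \<alpha> @ replicate j Star @ BarredStar # replicate l Star) \<longleftrightarrow> j = 0"
  by (auto simp: barred_star_first_def row_split_at_bar)

lemma barred_star_last_row_iff:
  "barred_star_last (map Part \<alpha> @ replicate j Star @ BarredStar # replicate l Star) \<longleftrightarrow> l = 0"
  by (auto simp: barred_star_last_def row_split_at_bar)

lemma row_parts_sync [simp]: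
  "row_parts (fst (sync \<alpha> \<beta>)) = \<alpha>" "row_parts (snd (sync \<alpha> \<beta>)) = \<beta>"
  by (simp_all add: sync_def)

section \<open>The zero part\<close>

lemma distinct_nonneg_partition_without_zero:
  "distinct_nonneg_partition \<beta> \<and> 0 \<notin> set \<beta> \<longleftrightarrow> distinct_positive_partition \<beta>"
  by (auto simp: distinct_nonneg_partition_def distinct_positive_partition_def intro: gr0I)

text \<open>The parts decrease, so a zero part can only be the last one, and it occurs once.\<close>

lemma distinct_nonneg_partition_with_zero:
  "distinct_nonneg_partition \<beta> \<and> 0 \<in> set \<beta> \<longleftrightarrow>
     (\<exists>\<gamma>. \<beta> = \<gamma> @ [0] \<and> distinct_positive_partition \<gamma>)"
proof
  assume *: "distinct_nonneg_partition \<beta> \<and> 0 \<in> set \<beta>"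
  then obtain \<gamma> x where \<beta>: "\<beta> = \<gamma> @ [x]"
    by (cases \<beta> rule: rev_cases) auto
  have "\<forall>y\<in>set \<gamma>. x < y" "sorted_wrt (>) \<gamma>"
    using * \<beta> by (auto simp: distinct_nonneg_partition_def sorted_wrt_append)
  moreover from this have "x = 0"
    using * \<beta> by auto
  ultimately show "\<exists>\<gamma>. \<beta> = \<gamma> @ [0] \<and> distinct_positive_partition \<gamma>"
    using \<beta> by (auto simp: distinct_positive_partition_def)
qed (auto simp: distinct_nonneg_partition_def distinct_positive_partition_def sorted_wrt_append)

lemma filter_positive_partition:
  "distinct_positive_partition \<beta> \<Longrightarrow> filter ((<) 0) \<beta> = \<beta>"
  by (simp add: distinct_positive_partition_def)

section \<open>Both sets are parametrized by pairs of positive partitions\<close>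

lemma unrooted_parametrization:
  "{S \<in> sync_partitions m n. weight S = p \<and> \<not> contains_zero_part S} =
     (\<lambda>(\<alpha>, \<beta>). sync \<alpha> \<beta>) ` positive_pairs m n p"
proof -
  have "weight (sync \<alpha> \<beta>) = sum_list \<alpha> + sum_list \<beta>"
    and "contains_zero_part (sync \<alpha> \<beta>) \<longleftrightarrow> 0 \<in> set \<beta>" for \<alpha> \<beta>
    by (auto simp: weight_def contains_zero_part_def sync_def)
  then show ?thesis
    by (fastforce simp: sync_partitions_def positive_pairs_def
        distinct_nonneg_partition_without_zero [symmetric])
qed

text \<open>
  Each of the two shapes of a degenerate array comes from exactly one of the two branches in the
  definition of the rooting. A bar in the bottom row forces positive discrepancy, hence no zero
  part and no star before the bar; a bar in the top row forces negative discrepancy, hence a zero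
  part and no star after the bar.
\<close>

lemma degenerate_rooted_imp_rooting:
  assumes S: "S \<in> rooted_sync_partitions m n" and p: "weight S = p" and deg: "degenerate S"
  shows "S \<in> (\<lambda>(\<alpha>, \<beta>). degenerate_rooting \<alpha> \<beta>) ` positive_pairs m n p"
proof -
  from S obtain \<alpha> \<beta> where \<alpha>: "distinct_positive_partition \<alpha>"
    and \<beta>: "distinct_nonneg_partition \<beta>"
    and bounds: "\<alpha> \<noteq> [] \<longrightarrow> hd \<alpha> \<le> m" "\<beta> \<noteq> [] \<longrightarrow> hd \<beta> \<le> n"
    and "S \<in> rootings (sync \<alpha> \<beta>)"
    unfolding rooted_sync_partitions_def sync_partitions_def by blast
  then consider
    (top) i where "i < length (fst (sync \<alpha> \<beta>))" "fst (sync \<alpha> \<beta>) ! i = Star"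
      "S = ((fst (sync \<alpha> \<beta>))[i := BarredStar], snd (sync \<alpha> \<beta>))"
  | (bottom) i where "i < length (snd (sync \<alpha> \<beta>))" "snd (sync \<alpha> \<beta>) ! i = Star"
      "S = (fst (sync \<alpha> \<beta>), (snd (sync \<alpha> \<beta>))[i := BarredStar])"
    by (auto simp: rootings_def sync_def)
  then show ?thesis
  proof cases
    case top
    let ?row = "map Part \<alpha> @ replicate (length \<beta> - length \<alpha>) Star"
    have "i < length ?row" "?row ! i = Star"
      using top by (simp_all add: sync_def)
    then obtain j l where k: "length \<beta> - length \<alpha> = j + Suc l"
      and row: "?row[i := BarredStar] =
        map Part \<alpha> @ replicate j Star @ BarredStar # replicate l Star"
      by (rule bar_star_in_row)
    have S_eq: "S = (map Part \<alpha> @ replicate j Star @ BarredStar # replicate l Star, map Part \<beta>)"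
      using top(3) row k by (simp add: sync_def)
    have "discrepancy S < 0" "0 \<in> set \<beta>" "l = 0"
      using deg k by (auto simp: S_eq degenerate_def discrepancy_def contains_zero_part_def
          barred_star_last_row_iff)
    moreover from this \<beta> obtain \<gamma> where \<gamma>: "\<beta> = \<gamma> @ [0]" "distinct_positive_partition \<gamma>"
      using distinct_nonneg_partition_with_zero by blast
    ultimately have "S = degenerate_rooting \<alpha> \<gamma>"
      using k by (auto simp: S_eq degenerate_rooting_def)
    moreover have "(\<alpha>, \<gamma>) \<in> positive_pairs m n p"
      using \<alpha> \<gamma> bounds p by (auto simp: positive_pairs_def S_eq weight_def hd_append)
    ultimately show ?thesis by auto
  next
    case bottom
    let ?row = "map Part \<beta> @ replicate (length \<alpha> - length \<beta>) Star"
    have "i < length ?row" "?row ! i = Star"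
      using bottom by (simp_all add: sync_def)
    then obtain j l where k: "length \<alpha> - length \<beta> = j + Suc l"
      and row: "?row[i := BarredStar] =
        map Part \<beta> @ replicate j Star @ BarredStar # replicate l Star"
      by (rule bar_star_in_row)
    have S_eq: "S = (map Part \<alpha>, map Part \<beta> @ replicate j Star @ BarredStar # replicate l Star)"
      using bottom(3) row k by (simp add: sync_def)
    have "0 \<notin> set \<beta>" "j = 0"
      using deg k by (auto simp: S_eq degenerate_def discrepancy_def contains_zero_part_def
          barred_star_first_row_iff)
    moreover from this \<beta> have "distinct_positive_partition \<beta>"
      using distinct_nonneg_partition_without_zero by blast
    ultimately have "S = degenerate_rooting \<alpha> \<beta>" "(\<alpha>, \<beta>) \<in> positive_pairs m n p"
      using k \<alpha> bounds p by (auto simp: S_eq degenerate_rooting_def positive_pairs_def weight_def)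
    then show ?thesis by auto
  qed
qed

lemma degenerate_rooting_is_degenerate_rooted:
  assumes "(\<alpha>, \<beta>) \<in> positive_pairs m n p"
  shows "degenerate_rooting \<alpha> \<beta> \<in> rooted_sync_partitions m n"
    and "weight (degenerate_rooting \<alpha> \<beta>) = p"
    and "degenerate (degenerate_rooting \<alpha> \<beta>)"
proof -
  have \<alpha>: "distinct_positive_partition \<alpha>" "\<alpha> \<noteq> [] \<longrightarrow> hd \<alpha> \<le> m"
    and \<beta>: "distinct_positive_partition \<beta>" "\<beta> \<noteq> [] \<longrightarrow> hd \<beta> \<le> n"
    using assms by (auto simp: positive_pairs_def)
  show "weight (degenerate_rooting \<alpha> \<beta>) = p"
    using assms by (auto simp: positive_pairs_def degenerate_rooting_def weight_def)
  show "degenerate (degenerate_rooting \<alpha> \<beta>)"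
  proof (cases "length \<beta> < length \<alpha>")
    case True
    then show ?thesis
      using \<beta> barred_star_first_row_iff [of \<beta> 0]
      by (auto simp: degenerate_def degenerate_rooting_def discrepancy_def contains_zero_part_def
          distinct_positive_partition_def)
  next
    case False
    then show ?thesis
      using barred_star_last_row_iff [of \<alpha> "length \<beta> - length \<alpha>" 0]
      by (auto simp: degenerate_def degenerate_rooting_def discrepancy_def contains_zero_part_def)
  qed
  show "degenerate_rooting \<alpha> \<beta> \<in> rooted_sync_partitions m n"
  proof (cases "length \<beta> < length \<alpha>")
    case True
    then obtain l where l: "length \<alpha> - length \<beta> = 0 + Suc l"
      by (metis add_0 Suc_pred zero_less_diff)
    have "sync \<alpha> \<beta> \<in> sync_partitions m n"
      using \<alpha> \<beta> distinct_nonneg_partition_without_zero by (auto simp: sync_partitions_def)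
    moreover have "degenerate_rooting \<alpha> \<beta> =
        (fst (sync \<alpha> \<beta>), (snd (sync \<alpha> \<beta>))[length \<beta> := BarredStar])"
      using True l star_in_row_barred [of \<beta> 0 l]
      by (simp add: degenerate_rooting_def sync_def)
    moreover have "snd (sync \<alpha> \<beta>) ! length \<beta> = Star" "length \<beta> < length (snd (sync \<alpha> \<beta>))"
      using True by (simp_all add: sync_def nth_append)
    ultimately show ?thesis
      by (auto simp: rooted_sync_partitions_def rootings_def case_prod_unfold intro!: bexI)
  next
    case False
    \<comment> \<open>Position \<open>length \<beta>\<close> is the column of the appended zero part, and it holds the last star.\<close>
    let ?i = "length \<beta>" and ?\<gamma> = "\<beta> @ [0]"
    have k: "length ?\<gamma> - length \<alpha> = (length \<beta> - length \<alpha>) + Suc 0"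
      using False by simp
    have "distinct_nonneg_partition ?\<gamma>"
      using \<beta> distinct_nonneg_partition_with_zero by blast
    moreover have "hd ?\<gamma> \<le> n"
      using \<beta> by (simp add: hd_append)
    ultimately have "sync \<alpha> ?\<gamma> \<in> sync_partitions m n"
      unfolding sync_partitions_def using \<alpha> by blast
    moreover have "degenerate_rooting \<alpha> \<beta> =
        ((fst (sync \<alpha> ?\<gamma>))[?i := BarredStar], snd (sync \<alpha> ?\<gamma>))"
      unfolding sync_def fst_conv snd_conv k
      using False star_in_row_barred [of \<alpha> "length \<beta> - length \<alpha>" 0]
      by (simp add: degenerate_rooting_def)
    moreover have "fst (sync \<alpha> ?\<gamma>) ! ?i = Star" "?i < length (fst (sync \<alpha> ?\<gamma>))"
      using False by (auto simp: sync_def nth_append simp del: replicate_Suc)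
    ultimately show ?thesis
      by (auto simp: rooted_sync_partitions_def rootings_def case_prod_unfold intro!: bexI)
  qed
qed

lemma degenerate_parametrization:
  "{S \<in> rooted_sync_partitions m n. weight S = p \<and> degenerate S} =
     (\<lambda>(\<alpha>, \<beta>). degenerate_rooting \<alpha> \<beta>) ` positive_pairs m n p"
proof (intro equalityI subsetI)
  fix S
  assume "S \<in> {S \<in> rooted_sync_partitions m n. weight S = p \<and> degenerate S}"
  then show "S \<in> (\<lambda>(\<alpha>, \<beta>). degenerate_rooting \<alpha> \<beta>) ` positive_pairs m n p"
    using degenerate_rooted_imp_rooting by blast
next
  fix S
  assume "S \<in> (\<lambda>(\<alpha>, \<beta>). degenerate_rooting \<alpha> \<beta>) ` positive_pairs m n p"
  then show "S \<in> {S \<in> rooted_sync_partitions m n. weight S = p \<and> degenerate S}"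
    using degenerate_rooting_is_degenerate_rooted by auto
qed

section \<open>The bijection and the signs\<close>

lemma unroot_degenerate_rooting:
  assumes "distinct_positive_partition \<beta>"
  shows "unroot_and_drop_zero (degenerate_rooting \<alpha> \<beta>) = sync \<alpha> \<beta>"
  using filter_positive_partition [OF assms]
  by (simp add: unroot_and_drop_zero_def degenerate_rooting_def)

text \<open>
  Even the numbers behind the two signs agree: the array with a zero part has discrepancy one
  further from \<open>0\<close>, and its additional star is the barred star in the top row.
\<close>

lemma sync_sign_eq_rooted_sign:
  "sync_sign (sync \<alpha> \<beta>) = rooted_sign (degenerate_rooting \<alpha> \<beta>)"
proof -
  have "rooted_star_count (degenerate_rooting \<alpha> \<beta>) = nat \<bar>discrepancy (sync \<alpha> \<beta>)\<bar>"
    by (auto simp: rooted_star_count_def degenerate_rooting_def discrepancy_def sync_def)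
  then show ?thesis
    by (simp add: sync_sign_def rooted_sign_def)
qed

theorem theorem3p2:
  fixes m n p :: nat
  shows "\<exists>f. bij_betw f
           {S \<in> rooted_sync_partitions m n. weight S = p \<and> degenerate S}
           {S \<in> sync_partitions m n. weight S = p \<and> \<not> contains_zero_part S} \<and>
         (\<forall>S \<in> {S \<in> rooted_sync_partitions m n. weight S = p \<and> degenerate S}.
            sync_sign (f S) = rooted_sign S)"
proof -
  let ?P = "positive_pairs m n p"
  let ?g = "\<lambda>S. degenerate_rooting (row_parts (fst S)) (row_parts (snd S))"
  have unroot: "unroot_and_drop_zero (degenerate_rooting \<alpha> \<beta>) = sync \<alpha> \<beta>"
    if "(\<alpha>, \<beta>) \<in> ?P" for \<alpha> \<beta>
    using that unroot_degenerate_rooting by (simp add: positive_pairs_def)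
  have "bij_betw unroot_and_drop_zero
          ((\<lambda>(\<alpha>, \<beta>). degenerate_rooting \<alpha> \<beta>) ` ?P) ((\<lambda>(\<alpha>, \<beta>). sync \<alpha> \<beta>) ` ?P)"
    by (rule bij_betw_byWitness [where f' = ?g]) (force simp: unroot)+
  moreover have "\<forall>S \<in> (\<lambda>(\<alpha>, \<beta>). degenerate_rooting \<alpha> \<beta>) ` ?P.
      sync_sign (unroot_and_drop_zero S) = rooted_sign S"
    by (auto simp: unroot sync_sign_eq_rooted_sign)
  ultimately show ?thesis
    unfolding unrooted_parametrization degenerate_parametrization by blast
qed

end
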